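(* Let $m<n$ be positive integers, $n=mN+r$ with $0\le r<m$ and $N=\lfloor n/m\rfloor$. Assume that under the prior the coefficients $\theta_1,\dots,\theta_N$ of $s^2=\sum_{k=1}^N\theta_k\mathbf 1_{B_k}$ are independent with the inverse gamma $\mathrm{IG}(\alpha,\beta)$ distribution, $\alpha,\beta>0$. Then, for the posterior based on the driftless Gaussian pseudo-likelihood, $\theta_1,\dots,\theta_N$ are a posteriori independent, and for $k=1,\dots,N-1$, $$\theta_k\mid\mathcal X_n\sim\mathrm{IG}\big(\alpha+m/2,\ \beta+nZ_k/2\big),\qquad Z_k=\sum_{i=(k-1)m+1}^{km}Y_{i,n}^2,$$ whereas $$\theta_N\mid\mathcal X_n\sim\mathrm{IG}\big(\alpha+(m+r)/2,\ \beta+nZ_N/2\big),\qquad Z_N=\sum_{i=(N-1)m+1}^{n}Y_{i,n}^2.$$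
   Context: Data: $\mathcal X_n=\{X_{t_{0,n}},\dots,X_{t_{n,n}}\}$, $t_{i,n}=i/n$, are discrete observations on $[0,1]$ of a real-valued process solving $dX_t=b_0(t,X_t)\,dt+s_0(t)\,dW_t$, $X_0=0$; $Y_{i,n}=X_{t_{i,n}}-X_{t_{i-1,n}}$. Bins: $B_k=[t_{m(k-1),n},t_{mk,n})$ for $k=1,\dots,N-1$ and $B_N=[t_{m(N-1),n},1]$. The prior on $s^2$ is the law of $\sum_{k=1}^N\theta_k\mathbf 1_{B_k}$. $\mathrm{IG}(a,b)$ is the distribution on $(0,\infty)$ with density proportional to $\theta^{-(a+1)}e^{-b/\theta}$. Posterior: with the pseudo-likelihood (acting as if the drift were zero) $$L_n(s)=\prod_{i=1}^n\frac{1}{\sqrt{2\pi\int_{t_{i-1,n}}^{t_{i,n}}s^2(u)\,du}}\exp\Big(-\frac{Y_{i,n}^2}{2\int_{t_{i-1,n}}^{t_{i,n}}s^2(u)\,du}\Big),$$ the posterior is $\Pi_n(S\mid\mathcal X_n)=\int_S L_n(s)\,\Pi_n(ds)\big/\int L_n(s)\,\Pi_n(ds)$, viewed as a distribution of $(\theta_1,\dots,\theta_N)$. *)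

theory Defs
  imports "HOL-Probability.Probability"
begin

definition grid :: "nat \<Rightarrow> nat \<Rightarrow> real" where
  "grid n i = real i / real n"

definition increment :: "nat \<Rightarrow> (real \<Rightarrow> real) \<Rightarrow> nat \<Rightarrow> real" where
  "increment n x i = x (grid n i) - x (grid n (i - 1))"

definition bin :: "nat \<Rightarrow> nat \<Rightarrow> nat \<Rightarrow> nat \<Rightarrow> real set" where
  "bin n m N k =
     (if k < N then {grid n (m * (k - 1)) ..< grid n (m * k)}
      else {grid n (m * (N - 1)) .. 1})"

definition sq_vol :: "nat \<Rightarrow> nat \<Rightarrow> nat \<Rightarrow> (nat \<Rightarrow> real) \<Rightarrow> real \<Rightarrow> real" where
  "sq_vol n m N \<theta> u = (\<Sum>k=1..N. \<theta> k * indicator (bin n m N k) u)"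

definition pseudo_likelihood :: "nat \<Rightarrow> (nat \<Rightarrow> real) \<Rightarrow> (real \<Rightarrow> real) \<Rightarrow> real" where
  "pseudo_likelihood n y s =
     (\<Prod>i=1..n.
        1 / sqrt (2 * pi * (LBINT u:{grid n (i - 1)..grid n i}. (s u)\<^sup>2)) *
        exp (- (y i)\<^sup>2 / (2 * (LBINT u:{grid n (i - 1)..grid n i}. (s u)\<^sup>2))))"

text \<open>The probability measure with density proportional to a nonnegative measurable \<open>f\<close>
  with respect to \<open>M\<close>: a set \<open>S\<close> has mass \<open>(\<integral>\<^sub>S f dM) / (\<integral> f dM)\<close>.  This is a probability
  measure exactly when the total integral is positive and finite.\<close>

definition normalized_density :: "'a measure \<Rightarrow> ('a \<Rightarrow> real) \<Rightarrow> 'a measure" where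
  "normalized_density M f = density M (\<lambda>x. ennreal (f x) / (\<integral>\<^sup>+ z. ennreal (f z) \<partial>M))"

definition inv_gamma :: "real \<Rightarrow> real \<Rightarrow> real measure" where
  "inv_gamma a b =
     normalized_density lborel
       (\<lambda>x. indicator {0<..} x * (x powr (- (a + 1)) * exp (- b / x)))"

text \<open>The prior and the posterior are measures on coefficient vectors, that is, on
  \<open>\<Pi>\<^sub>M k\<in>{1..N}. borel\<close>.  The likelihood is a function of the volatility \<open>s\<close> and is evaluated at
  the root of the squared volatility; coefficient vectors with nonpositive entries,
  where this reading is immaterial, are null under an inverse gamma prior.\<close>

definition posterior ::
  "nat \<Rightarrow> nat \<Rightarrow> nat \<Rightarrow> (nat \<Rightarrow> real) \<Rightarrow> (nat \<Rightarrow> real) measure \<Rightarrow> (nat \<Rightarrow> real) measure" where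
  "posterior n m N y prior =
     normalized_density prior
       (\<lambda>\<theta>. pseudo_likelihood n y (\<lambda>u. sqrt (sq_vol n m N \<theta> u)))"

end

theory Submission
  imports Defs
begin

text \<open>
  The result is conjugacy of the inverse gamma family for the variance of a centred Gaussian,
  applied in every bin separately.

  The bins are unions of observation cells, so for positive \<open>\<theta>\<close> the integral of \<open>s\<^sup>2\<close> over a cell
  of the \<open>k\<close>-th bin is \<open>\<theta>\<^sub>k / n\<close> (lemma \<open>integral_sq_vol_cell\<close>).  The Gaussian factor of that cell is
  therefore a constant times \<open>\<theta>\<^sub>k\<^bsup>-1/2\<^esup> exp (- (n Y\<^sub>i\<^sup>2 / 2) / \<theta>\<^sub>k)\<close>.  Multiplying over the
  cells of each bin writes the pseudo-likelihood as a product over \<open>k\<close> of functions of \<open>\<theta>\<^sub>k\<close> alone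
  (lemma \<open>pseudo_likelihood_factorization\<close>): a constant times \<open>\<theta>\<^sub>k\<^bsup>-c/2\<^esup> exp (- (n Z\<^sub>k / 2) / \<theta>\<^sub>k)\<close>,
  where \<open>c\<close> is the number of cells in the bin, that is \<open>m\<close>, or \<open>m + r\<close> for the last bin.

  An independent prior is the product measure of its marginals, and weighting a product measure by
  a product function gives the product of the weighted marginals (lemma \<open>normalized_density_PiM\<close>).
  So the posterior is a product measure, which is the independence claim, and its \<open>k\<close>-th factor is
  \<open>IG(\<alpha>, \<beta>)\<close> weighted by the function above.  Multiplying the densities adds \<open>c/2\<close> to the shape
  and \<open>n Z\<^sub>k / 2\<close> to the scale (lemma \<open>inv_gamma_conjugacy\<close>).

  The analytic content is that all normalising constants are positive and finite, without which
  the weighted measures would be degenerate; this rests on the integrability of the inverse gamma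
  kernel (lemma \<open>nn_integral_ig_weight_finite\<close>).
\<close>

section \<open>Measures given by unnormalised densities\<close>

lemma ennreal_pos_finiteE:
  fixes c :: ennreal
  assumes "0 < c" "c < \<infinity>"
  obtains C where "c = ennreal C" "0 < C"
  using assms by (cases c) auto

text \<open>The integral \<open>\<integral>\<^sup>+\<close> depends only on the almost-everywhere class of its integrand, for arbitrary
  functions.  This allows the pseudo-likelihood to be replaced by its closed form, which agrees with
  it on positive coefficient vectors.\<close>

lemma normalized_density_cong_AE:
  assumes "AE x in M. f x = g x"
  shows "normalized_density M f = normalized_density M g"
proof -
  have "(\<integral>\<^sup>+ x. ennreal (f x) \<partial>M) = (\<integral>\<^sup>+ x. ennreal (g x) \<partial>M)"
    using assms by (intro nn_integral_cong_AE) auto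
  moreover have "(\<integral>\<^sup>+ x. ennreal (f x) / c * indicator A x \<partial>M)
      = (\<integral>\<^sup>+ x. ennreal (g x) / c * indicator A x \<partial>M)" for c A
    using assms by (intro nn_integral_cong_AE) auto
  ultimately show ?thesis
    unfolding normalized_density_def density_def by simp
qed

lemma sets_normalized_density [measurable_cong, simp]:
  "sets (normalized_density M f) = sets M"
  by (simp add: normalized_density_def)

lemma prob_space_normalized_density:
  assumes [measurable]: "f \<in> borel_measurable M"
    and "0 < (\<integral>\<^sup>+ x. ennreal (f x) \<partial>M)" "(\<integral>\<^sup>+ x. ennreal (f x) \<partial>M) < \<infinity>"
  shows "prob_space (normalized_density M f)"
proof
  show "emeasure (normalized_density M f) (space (normalized_density M f)) = 1"
    using assms unfolding normalized_density_def
    by (subst emeasure_density)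
       (auto cong: nn_integral_cong simp: nn_integral_divide)
qed

lemma normalized_density_scale:
  assumes [measurable]: "f \<in> borel_measurable M"
    and nonneg: "\<And>x. 0 \<le> f x" and "0 < c"
  shows "normalized_density M (\<lambda>x. c * f x) = normalized_density M f"
proof -
  have "ennreal (c * f x) / (ennreal c * z) = ennreal (f x) / z" for x z
    using \<open>0 < c\<close> nonneg divide_mult_eq[of "ennreal c" "ennreal (f x)" z]
    by (simp add: ennreal_mult mult.commute)
  moreover have "(\<integral>\<^sup>+ x. ennreal (c * f x) \<partial>M) = ennreal c * (\<integral>\<^sup>+ x. ennreal (f x) \<partial>M)"
    using \<open>0 < c\<close> nonneg by (simp add: ennreal_mult nn_integral_cmult)
  ultimately show ?thesis
    by (simp add: normalized_density_def)
qed

lemma nn_integral_normalized_density: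
  assumes [measurable]: "f \<in> borel_measurable M" "g \<in> borel_measurable M"
    and nonneg: "\<And>x. 0 \<le> f x" "\<And>x. 0 \<le> g x"
  shows "(\<integral>\<^sup>+ x. ennreal (g x) \<partial>normalized_density M f)
    = (\<integral>\<^sup>+ x. ennreal (f x * g x) \<partial>M) / (\<integral>\<^sup>+ x. ennreal (f x) \<partial>M)"
  unfolding normalized_density_def
  by (subst nn_integral_density)
     (auto simp: nonneg ennreal_mult nn_integral_divide[symmetric] ennreal_divide_times
        ennreal_times_divide intro!: nn_integral_cong)

text \<open>Bayes updating of a measure that is itself given by an unnormalised density: the two weights
  multiply, and the inner normalising constant cancels against the one it introduces in the outer
  total mass.  Both total masses must be positive and finite for this cancellation.\<close>

lemma normalized_density_normalized_density:
  assumes [measurable]: "f \<in> borel_measurable M" "g \<in> borel_measurable M"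
    and nonneg: "\<And>x. 0 \<le> f x" "\<And>x. 0 \<le> g x"
    and f: "0 < (\<integral>\<^sup>+ x. ennreal (f x) \<partial>M)" "(\<integral>\<^sup>+ x. ennreal (f x) \<partial>M) < \<infinity>"
    and fg: "0 < (\<integral>\<^sup>+ x. ennreal (f x * g x) \<partial>M)" "(\<integral>\<^sup>+ x. ennreal (f x * g x) \<partial>M) < \<infinity>"
  shows "normalized_density (normalized_density M f) g = normalized_density M (\<lambda>x. f x * g x)"
proof -
  obtain F where F: "(\<integral>\<^sup>+ x. ennreal (f x) \<partial>M) = ennreal F" "0 < F"
    using f by (rule ennreal_pos_finiteE)
  obtain G where G: "(\<integral>\<^sup>+ x. ennreal (f x * g x) \<partial>M) = ennreal G" "0 < G"
    using fg by (rule ennreal_pos_finiteE)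
  have "normalized_density (normalized_density M f) g
      = density (density M (\<lambda>x. ennreal (f x) / F)) (\<lambda>x. ennreal (g x) / (ennreal G / F))"
    using nn_integral_normalized_density[OF assms(1,2) nonneg] F G
    by (simp add: normalized_density_def)
  also have "\<dots> = density M (\<lambda>x. ennreal (f x) / F * (ennreal (g x) / (ennreal G / F)))"
    by (rule density_density_eq) measurable
  also have "\<dots> = density M (\<lambda>x. ennreal (f x * g x) / ennreal G)"
  proof -
    have "ennreal (f x) / F * (ennreal (g x) / (ennreal G / F)) = ennreal (f x * g x) / ennreal G" for x
      using F G nonneg
      by (simp add: divide_ennreal ennreal_mult[symmetric] field_simps)
    then show ?thesis by simp
  qed
  finally show ?thesis
    by (simp add: normalized_density_def G)
qed

text \<open>A product weight on a product measure acts coordinatewise.  By Tonelli the normalising constant is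
  the product of the coordinatewise ones, so on a box both sides reduce to the same product of
  one-dimensional integrals, and boxes determine a finite product measure.\<close>

lemma normalized_density_PiM:
  assumes fin: "finite I"
    and M: "\<And>i. sigma_finite_measure (M i)"
    and [measurable]: "\<And>i. f i \<in> borel_measurable (M i)"
    and nonneg: "\<And>i x. 0 \<le> f i x"
    and f: "\<And>i. 0 < (\<integral>\<^sup>+ x. ennreal (f i x) \<partial>M i)" "\<And>i. (\<integral>\<^sup>+ x. ennreal (f i x) \<partial>M i) < \<infinity>"
  shows "normalized_density (PiM I M) (\<lambda>x. \<Prod>i\<in>I. f i (x i))
    = PiM I (\<lambda>i. normalized_density (M i) (f i))"
proof -
  interpret M: product_sigma_finite M
    using M by (simp add: product_sigma_finite_def)
  have prob: "prob_space (normalized_density (M i) (f i))" for i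
    using f by (intro prob_space_normalized_density) auto
  interpret D: product_prob_space "\<lambda>i. normalized_density (M i) (f i)" I
    by (rule product_prob_spaceI) (rule prob)
  have "\<exists>C. \<forall>i. (\<integral>\<^sup>+ x. ennreal (f i x) \<partial>M i) = ennreal (C i) \<and> 0 < C i"
    by (rule choice) (metis ennreal_pos_finiteE f)
  then obtain C where C: "\<And>i. (\<integral>\<^sup>+ x. ennreal (f i x) \<partial>M i) = ennreal (C i)" "\<And>i. 0 < C i"
    by blast
  have total: "(\<integral>\<^sup>+ x. ennreal (\<Prod>i\<in>I. f i (x i)) \<partial>PiM I M) = ennreal (\<Prod>i\<in>I. C i)"
    using M.product_nn_integral_prod[OF fin, of "\<lambda>i x. ennreal (f i x)"] C
    by (simp add: prod_ennreal nonneg less_imp_le)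
  have split: "ennreal (\<Prod>i\<in>I. f i (x i)) / ennreal (\<Prod>i\<in>I. C i)
      = (\<Prod>i\<in>I. ennreal (f i (x i)) / ennreal (C i))" for x
    using C(2) nonneg
    by (simp add: divide_ennreal prod_nonneg prod_pos prod_ennreal prod_dividef less_imp_le)
  show ?thesis
  proof (rule D.PiM_eqI[OF fin])
    show "sets (normalized_density (PiM I M) (\<lambda>x. \<Prod>i\<in>I. f i (x i)))
        = sets (PiM I (\<lambda>i. normalized_density (M i) (f i)))"
      by (simp cong: sets_PiM_cong)
  next
    fix A assume "\<And>i. i \<in> I \<Longrightarrow> A i \<in> sets (normalized_density (M i) (f i))"
    then have A [measurable]: "\<And>i. i \<in> I \<Longrightarrow> A i \<in> sets (M i)" by simp
    have ind: "indicator (Pi\<^sub>E I A) x = (\<Prod>i\<in>I. indicator (A i) (x i) :: ennreal)"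
      if "x \<in> space (PiM I M)" for x
      using that fin by (auto simp: indicator_def space_PiM PiE_iff prod_zero_iff intro!: prod.neutral)
    have "emeasure (normalized_density (PiM I M) (\<lambda>x. \<Prod>i\<in>I. f i (x i))) (Pi\<^sub>E I A)
        = (\<integral>\<^sup>+ x. (\<Prod>i\<in>I. ennreal (f i (x i)) / ennreal (C i)) * indicator (Pi\<^sub>E I A) x \<partial>PiM I M)"
      unfolding normalized_density_def total split
      by (rule emeasure_density) (auto intro!: sets_PiM_I_finite fin A)
    also have "\<dots> = (\<integral>\<^sup>+ x. (\<Prod>i\<in>I. ennreal (f i (x i)) / ennreal (C i) * indicator (A i) (x i)) \<partial>PiM I M)"
      by (intro nn_integral_cong) (simp add: ind prod.distrib)
    also have "\<dots> = (\<Prod>i\<in>I. \<integral>\<^sup>+ x. ennreal (f i x) / ennreal (C i) * indicator (A i) x \<partial>M i)"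
      by (rule M.product_nn_integral_prod[OF fin]) measurable
    also have "\<dots> = (\<Prod>i\<in>I. emeasure (normalized_density (M i) (f i)) (A i))"
      by (intro prod.cong refl) (simp add: normalized_density_def C emeasure_density)
    finally show "emeasure (normalized_density (PiM I M) (\<lambda>x. \<Prod>i\<in>I. f i (x i))) (Pi\<^sub>E I A)
        = (\<Prod>i\<in>I. emeasure (normalized_density (M i) (f i)) (A i))" .
  qed
qed

section \<open>Inverse gamma conjugacy\<close>

text \<open>The exponent is \<open>-a\<close>, not the \<open>-(a + 1)\<close> of the inverse gamma density: with this convention a
  product of weights adds both parameters, so that inverse gamma kernels and Gaussian likelihood
  factors are handled by one rule.\<close>

definition ig_weight :: "real \<Rightarrow> real \<Rightarrow> real \<Rightarrow> real" where
  "ig_weight a b x = x powr (- a) * exp (- b / x)"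

lemma ig_weight_measurable [measurable]: "ig_weight a b \<in> borel_measurable borel"
  unfolding ig_weight_def[abs_def] by measurable

lemma ig_weight_nonneg [simp]: "0 \<le> ig_weight a b x"
  by (simp add: ig_weight_def)

lemma ig_weight_mult: "ig_weight a b x * ig_weight a' b' x = ig_weight (a + a') (b + b') x"
proof -
  have "- (a + a') = - a + - a'" "- (b + b') / x = - b / x + - b' / x"
    by (simp_all add: add_divide_distrib diff_divide_distrib)
  then show ?thesis
    by (simp only: ig_weight_def powr_add exp_add mult_ac)
qed

lemma prod_ig_weight:
  assumes "0 < x"
  shows "(\<Prod>i\<in>A. ig_weight a (b i) x) = ig_weight (real (card A) * a) (\<Sum>i\<in>A. b i) x"
  using assms
  by (induction A rule: infinite_finite_induct)
     (auto simp: ig_weight_mult algebra_simps, auto simp: ig_weight_def)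

lemma inv_gamma_eq:
  "inv_gamma a b = normalized_density lborel (\<lambda>x. indicator {0<..} x * ig_weight (a + 1) b x)"
  by (simp add: inv_gamma_def ig_weight_def)

text \<open>The bound is the estimate \<open>s \<le> exp s\<close>, raised to the power \<open>a\<close>, at the point \<open>s = b / (a * x)\<close>,
  where the exponential becomes exactly \<open>exp (b / x)\<close>.\<close>

lemma ig_weight_bounded:
  assumes "0 < a" "0 < b" "0 < x"
  shows "ig_weight a b x \<le> (a / b) powr a"
proof -
  define s where "s = b / (a * x)"
  have s: "0 < s" using assms by (simp add: s_def)
  have "s powr a \<le> exp s powr a"
    using s assms exp_ge_add_one_self[of s] by (intro powr_mono2) linarith+
  also have "\<dots> = exp (b / x)"
    using assms by (simp add: powr_def s_def)
  finally have "s powr a * exp (- b / x) \<le> 1"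
    by (simp add: exp_minus field_simps)
  moreover have "ig_weight a b x = (a / b) powr a * (s powr a * exp (- b / x))"
  proof -
    have "(a / b) powr a * s powr a = (a / b * s) powr a"
      by (rule powr_mult[symmetric])
    also have "a / b * s = 1 / x"
      using assms by (simp add: s_def)
    also have "(1 / x) powr a = x powr (- a)"
      using assms by (simp add: powr_divide powr_minus_divide)
    finally show ?thesis by (simp add: ig_weight_def)
  qed
  ultimately show ?thesis
    using mult_left_mono[of "s powr a * exp (- b / x)" 1 "(a / b) powr a"] by simp
qed

text \<open>On \<open>(0, 1]\<close> the exponential suppresses the singularity of the power and the kernel is bounded;
  on \<open>[1, \<infinity>)\<close> the exponential is at most \<open>1\<close> and the remaining power is integrable.\<close>

lemma nn_integral_ig_weight_finite:
  assumes "0 < a" "0 < b"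
  shows "(\<integral>\<^sup>+ x. ennreal (indicator {0<..} x * ig_weight (a + 1) b x) \<partial>lborel) < \<infinity>"
proof -
  let ?K = "((a + 1) / b) powr (a + 1)"
  have "(\<integral>\<^sup>+ x. ennreal (x powr (- a - 1)) * indicator {1..} x \<partial>lborel) = ennreal (0 - - (1 powr - a) / a)"
  proof (rule nn_integral_FTC_atLeast[where F = "\<lambda>x. - (x powr (- a)) / a"])
    show "((\<lambda>x. - (x powr - a) / a) \<longlongrightarrow> 0) at_top"
      using tendsto_divide[OF tendsto_minus[OF tendsto_neg_powr[OF _ filterlim_ident, of "- a"]] tendsto_const[of a]] assms
      by simp
  next
    fix x :: real assume "1 \<le> x"
    then show "((\<lambda>x. - (x powr - a) / a) has_real_derivative x powr (- a - 1)) (at x)"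
      using assms by (auto intro!: derivative_eq_intros simp: powr_diff)
  qed auto
  then have tail: "(\<integral>\<^sup>+ x. ennreal (x powr (- a - 1)) * indicator {1..} x \<partial>lborel) < \<infinity>"
    by simp
  have "(\<integral>\<^sup>+ x. ennreal (indicator {0<..} x * ig_weight (a + 1) b x) \<partial>lborel)
     \<le> (\<integral>\<^sup>+ x. ennreal ?K * indicator {0..1} x + ennreal (x powr (- a - 1)) * indicator {1..} x \<partial>lborel)"
  proof (rule nn_integral_mono)
    fix x :: real
    consider "x \<le> 0" | "0 < x" "x \<le> 1" | "1 < x" by linarith
    then show "ennreal (indicator {0<..} x * ig_weight (a + 1) b x)
        \<le> ennreal ?K * indicator {0..1} x + ennreal (x powr (- a - 1)) * indicator {1..} x"
    proof cases
      case 2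
      then have "ennreal (indicator {0<..} x * ig_weight (a + 1) b x) \<le> ennreal ?K"
        using ig_weight_bounded[of "a + 1" b x] assms by (auto intro: ennreal_leI)
      also have "\<dots> \<le> ennreal ?K * indicator {0..1} x + ennreal (x powr (- a - 1)) * indicator {1..} x"
        using 2 by simp
      finally show ?thesis .
    next
      case 3
      then have "x powr (- a - 1) * exp (- b / x) \<le> x powr (- a - 1) * 1"
        using assms by (intro mult_left_mono) auto
      then show ?thesis using 3 by (auto simp: ig_weight_def intro!: ennreal_leI)
    qed auto
  qed
  also have "\<dots> = ennreal ?K + (\<integral>\<^sup>+ x. ennreal (x powr (- a - 1)) * indicator {1..} x \<partial>lborel)"
    by (simp add: nn_integral_add nn_integral_cmult_indicator)
  also have "\<dots> < \<infinity>" using tail by simp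
  finally show ?thesis .
qed

lemma nn_integral_ig_weight_pos:
  "0 < (\<integral>\<^sup>+ x. ennreal (indicator {0<..} x * ig_weight a b x) \<partial>lborel)"
proof -
  have "\<not> (AE x in lborel. ennreal (indicator {0<..} x * ig_weight a b x) = 0)"
  proof
    assume "AE x in lborel. ennreal (indicator {0<..} x * ig_weight a b x) = 0"
    then have "AE x in lborel. x \<notin> {0<..<1::real}"
      by eventually_elim (auto simp: ig_weight_def ennreal_eq_0_iff mult_le_0_iff)
    then have "emeasure lborel {0<..<1::real} = 0"
      by (subst (asm) AE_iff_measurable[OF _ refl]) (auto simp: greaterThanLessThan_def greaterThan_def lessThan_def Collect_conj_eq)
    then show False by simp
  qed
  then show ?thesis
    by (subst zero_less_iff_neq_zero, subst nn_integral_0_iff_AE) auto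
qed

lemma sets_inv_gamma [measurable_cong, simp]: "sets (inv_gamma a b) = sets borel"
  by (simp add: inv_gamma_def)

lemma prob_space_inv_gamma:
  assumes "0 < a" "0 < b"
  shows "prob_space (inv_gamma a b)"
  unfolding inv_gamma_eq
  using assms nn_integral_ig_weight_finite nn_integral_ig_weight_pos
  by (intro prob_space_normalized_density) auto

lemma AE_inv_gamma_pos: "AE x in inv_gamma a b. 0 < x"
  unfolding inv_gamma_eq normalized_density_def
  by (subst AE_density) (auto simp: indicator_def)

text \<open>Multiplying the kernel of \<open>IG(a, b)\<close> by the weight with parameters \<open>p, q\<close> gives the
  kernel of \<open>IG(a + p, b + q)\<close>.  The first two parts say that the update is well defined; the
  weight itself need not be bounded (for \<open>p > 0\<close> and \<open>q = 0\<close> it blows up at \<open>0\<close>), so this too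
  is read off from the product kernel.\<close>

lemma inv_gamma_conjugacy:
  assumes "0 < a" "0 < b" "0 \<le> p" "0 \<le> q" "0 < c"
  shows "0 < (\<integral>\<^sup>+ x. ennreal (c * ig_weight p q x) \<partial>inv_gamma a b)" (is ?pos)
    and "(\<integral>\<^sup>+ x. ennreal (c * ig_weight p q x) \<partial>inv_gamma a b) < \<infinity>" (is ?fin)
    and "normalized_density (inv_gamma a b) (\<lambda>x. c * ig_weight p q x) = inv_gamma (a + p) (b + q)" (is ?post)
proof -
  let ?k = "\<lambda>a b x. indicator {0<..} x * ig_weight (a + 1) b x :: real"
  \<comment> \<open>The scale \<open>c\<close> of the likelihood comes out as a constant and disappears on normalising.\<close>
  have kernel: "?k a b x * (c * ig_weight p q x) = c * ?k (a + p) (b + q) x" for x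
    using ig_weight_mult[of "a + 1" b x p q] by (simp add: algebra_simps)
  have prior: "0 < (\<integral>\<^sup>+ x. ennreal (?k a b x) \<partial>lborel)" "(\<integral>\<^sup>+ x. ennreal (?k a b x) \<partial>lborel) < \<infinity>"
    using assms nn_integral_ig_weight_pos nn_integral_ig_weight_finite by auto
  have post: "0 < (\<integral>\<^sup>+ x. ennreal (?k a b x * (c * ig_weight p q x)) \<partial>lborel)"
    "(\<integral>\<^sup>+ x. ennreal (?k a b x * (c * ig_weight p q x)) \<partial>lborel) < \<infinity>"
    using assms nn_integral_ig_weight_pos[of "a + p + 1" "b + q"]
      nn_integral_ig_weight_finite[of "a + p" "b + q"]
    by (auto simp only: kernel)
       (auto simp: ennreal_mult nn_integral_cmult ennreal_zero_less_mult_iff ennreal_mult_less_top)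
  have "(\<integral>\<^sup>+ x. ennreal (c * ig_weight p q x) \<partial>inv_gamma a b)
      = (\<integral>\<^sup>+ x. ennreal (?k a b x * (c * ig_weight p q x)) \<partial>lborel) / (\<integral>\<^sup>+ x. ennreal (?k a b x) \<partial>lborel)"
    unfolding inv_gamma_eq using assms by (intro nn_integral_normalized_density) auto
  with prior post show ?pos ?fin
    by (simp_all add: ennreal_zero_less_divide ennreal_divide_eq_top_iff less_top[symmetric] zero_less_iff_neq_zero)
  have "normalized_density (inv_gamma a b) (\<lambda>x. c * ig_weight p q x)
      = normalized_density lborel (\<lambda>x. ?k a b x * (c * ig_weight p q x))"
    unfolding inv_gamma_eq using assms prior post
    by (intro normalized_density_normalized_density) auto
  also have "\<dots> = inv_gamma (a + p) (b + q)"
    unfolding kernel inv_gamma_eq using \<open>0 < c\<close> by (intro normalized_density_scale) auto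
  finally show ?post .
qed

section \<open>Bins as blocks of observation cells\<close>

text \<open>The indices \<open>i\<close> of the observation cells \<open>[(i - 1) / n, i / n)\<close> that make up the \<open>k\<close>-th bin; the
  last bin absorbs the remainder of the division of \<open>n\<close> by \<open>m\<close>.\<close>

definition bin_indices :: "nat \<Rightarrow> nat \<Rightarrow> nat \<Rightarrow> nat \<Rightarrow> nat set" where
  "bin_indices n m N k = {(k - 1) * m + 1..(if k < N then k * m else n)}"

lemma disjoint_bin_indices:
  "disjoint_family_on (bin_indices n m N) {1..N}"
proof -
  have "bin_indices n m N j \<inter> bin_indices n m N k = {}" if "j < k" "k \<le> N" for j k
  proof -
    have "j * m \<le> (k - 1) * m" using that by (intro mult_right_mono) auto
    moreover have "i \<le> j * m" if "i \<in> bin_indices n m N j" for i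
      using that \<open>j < k\<close> \<open>k \<le> N\<close> by (simp add: bin_indices_def)
    moreover have "(k - 1) * m < i" if "i \<in> bin_indices n m N k" for i
      using that by (simp add: bin_indices_def)
    ultimately show ?thesis by (meson disjoint_iff leD le_trans)
  qed
  then show ?thesis
    unfolding disjoint_family_on_def by (metis Int_commute atLeastAtMost_iff linorder_neqE_nat)
qed

lemma UN_bin_indices:
  assumes "0 < m" "0 < N" "m * N \<le> n"
  shows "(\<Union>k\<in>{1..N}. bin_indices n m N k) = {1..n}"
proof (intro equalityI subsetI)
  fix i assume i: "i \<in> {1..n}"
  \<comment> \<open>\<open>q + 1\<close> would be the bin of \<open>i\<close> if all bins had \<open>m\<close> cells; the last bin takes every
    \<open>q \<ge> N - 1\<close>.\<close>
  define q where "q = (i - 1) div m"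
  have q: "q * m \<le> i - 1" "i - 1 < (q + 1) * m"
    using \<open>0 < m\<close> by (simp_all add: q_def div_times_less_eq_dividend dividend_less_div_times)
  show "i \<in> (\<Union>k\<in>{1..N}. bin_indices n m N k)"
  proof (cases "q + 1 < N")
    case True
    then show ?thesis using i q by (intro UN_I[of "q + 1"]) (auto simp: bin_indices_def)
  next
    case False
    then have "(N - 1) * m \<le> q * m" by (intro mult_right_mono) auto
    then have "(N - 1) * m + 1 \<le> i" using i q(1) by (simp only: atLeastAtMost_iff) linarith
    then show ?thesis using i \<open>0 < N\<close> by (intro UN_I[of N]) (auto simp: bin_indices_def)
  qed
next
  fix i assume "i \<in> (\<Union>k\<in>{1..N}. bin_indices n m N k)"
  then obtain k where k: "k \<le> N" "i \<in> bin_indices n m N k" by auto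
  have "k * m \<le> N * m" using k(1) by (rule mult_le_mono1)
  also have "\<dots> \<le> n" using assms(3) by (simp add: mult.commute)
  finally have "k * m \<le> n" .
  with k show "i \<in> {1..n}" by (auto simp: bin_indices_def split: if_splits)
qed

text \<open>The end points of the bins are grid points, and a point of the \<open>i\<close>-th cell lies at or to the
  right of exactly the grid points of index below \<open>i\<close>.  Hence bin membership is decided by \<open>i\<close> alone.\<close>

lemma mem_bin_iff:
  assumes "0 < n" "i \<in> {1..n}" "k \<in> {1..N}"
    and u: "grid n (i - 1) \<le> u" "u < grid n i"
  shows "u \<in> bin n m N k \<longleftrightarrow> i \<in> bin_indices n m N k"
proof -
  have cell: "grid n l \<le> u \<longleftrightarrow> l < i" for l
  proof
    assume "grid n l \<le> u"
    with u have "grid n l < grid n i" by simp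
    then show "l < i" using \<open>0 < n\<close> by (simp add: grid_def divide_less_cancel)
  next
    assume "l < i"
    then have "grid n l \<le> grid n (i - 1)" by (simp add: grid_def divide_right_mono)
    with u show "grid n l \<le> u" by simp
  qed
  have "grid n i \<le> 1" using assms by (simp add: grid_def)
  with u have "u \<le> 1" by simp
  have "u < grid n l \<longleftrightarrow> i \<le> l" for l
    using cell[of l] by (metis not_le)
  with cell \<open>u \<le> 1\<close> assms show ?thesis
    by (cases "k < N") (auto simp: bin_def bin_indices_def mult.commute Suc_le_eq)
qed

lemma sq_vol_eq_on_cell:
  assumes "0 < n" "i \<in> {1..n}" "k \<in> {1..N}" "i \<in> bin_indices n m N k"
    and u: "grid n (i - 1) \<le> u" "u < grid n i"
  shows "sq_vol n m N \<theta> u = \<theta> k"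
proof -
  have "u \<in> bin n m N j \<longleftrightarrow> j = k" if "j \<in> {1..N}" for j
    using mem_bin_iff[OF assms(1,2) that u] that assms(3,4)
      disjoint_family_onD[OF disjoint_bin_indices[of n m N], of j k] by blast
  then have "sq_vol n m N \<theta> u = (\<Sum>j\<in>{1..N}. if j = k then \<theta> k else 0)"
    unfolding sq_vol_def by (intro sum.cong) auto
  also have "\<dots> = \<theta> k" using assms(3) by simp
  finally show ?thesis .
qed

text \<open>The squared volatility is constant on each half-open cell; on the closed cell it may jump at the
  right end point, which is a null set.\<close>

lemma integral_sq_vol_cell:
  assumes "0 < n" "i \<in> {1..n}" "k \<in> {1..N}" "i \<in> bin_indices n m N k"
    and pos: "\<And>k. k \<in> {1..N} \<Longrightarrow> 0 < \<theta> k"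
  shows "(LBINT u:{grid n (i - 1)..grid n i}. (sqrt (sq_vol n m N \<theta> u))\<^sup>2) = \<theta> k / real n"
proof -
  have [measurable]: "bin n m N j \<in> sets borel" for j
    by (auto simp: bin_def)
  have [measurable]: "sq_vol n m N \<theta> \<in> borel_measurable borel"
    unfolding sq_vol_def[abs_def] by measurable
  have "(LBINT u:{grid n (i - 1)..grid n i}. (sqrt (sq_vol n m N \<theta> u))\<^sup>2)
      = (LBINT u:{grid n (i - 1)..grid n i}. \<theta> k)"
    unfolding set_lebesgue_integral_def
  proof (rule integral_cong_AE)
    show "AE u in lborel. indicator {grid n (i - 1)..grid n i} u *\<^sub>R (sqrt (sq_vol n m N \<theta> u))\<^sup>2
        = indicator {grid n (i - 1)..grid n i} u *\<^sub>R \<theta> k"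
      using AE_lborel_singleton[of "grid n i"]
    proof eventually_elim
      case (elim u)
      show ?case
      proof (cases "u \<in> {grid n (i - 1)..grid n i}")
        case True
        with elim have "sq_vol n m N \<theta> u = \<theta> k"
          using assms by (intro sq_vol_eq_on_cell) auto
        then show ?thesis using pos[OF assms(3)] by simp
      qed simp
    qed
  qed measurable
  also have "\<dots> = \<theta> k * (grid n i - grid n (i - 1))"
    by (subst set_integral_const) (auto simp: grid_def divide_right_mono)
  also have "grid n i - grid n (i - 1) = 1 / real n"
    using assms(2) by (auto simp: grid_def diff_divide_distrib[symmetric] of_nat_diff)
  finally show ?thesis by simp
qed

section \<open>Factorisation of the pseudo-likelihood\<close>

lemma gaussian_factor_eq:
  assumes "0 < n" "0 < t"
  shows "1 / sqrt (2 * pi * (t / real n)) * exp (- y\<^sup>2 / (2 * (t / real n)))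
    = sqrt (real n / (2 * pi)) * ig_weight (1 / 2) (real n * y\<^sup>2 / 2) t"
  using assms
  by (simp add: ig_weight_def powr_minus powr_half_sqrt real_sqrt_divide real_sqrt_mult field_simps)

text \<open>The Gaussian factor of observation \<open>i\<close> involves only the coefficient of the bin that contains
  the \<open>i\<close>-th cell.  Grouping the factors by bins separates the variables, and within a bin the
  weights multiply to a single inverse gamma type weight.\<close>

lemma pseudo_likelihood_factorization:
  assumes "0 < m" "0 < N" "m * N \<le> n"
    and pos: "\<And>k. k \<in> {1..N} \<Longrightarrow> 0 < \<theta> k"
  shows "pseudo_likelihood n y (\<lambda>u. sqrt (sq_vol n m N \<theta> u)) =
    (\<Prod>k=1..N. sqrt (real n / (2 * pi)) ^ card (bin_indices n m N k) *
      ig_weight (real (card (bin_indices n m N k)) / 2)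
        (real n * (\<Sum>i\<in>bin_indices n m N k. (y i)\<^sup>2) / 2) (\<theta> k))"
proof -
  have "0 < n" using assms by (metis mult_pos_pos less_le_trans)
  let ?g = "\<lambda>i. 1 / sqrt (2 * pi * (LBINT u:{grid n (i - 1)..grid n i}. (sqrt (sq_vol n m N \<theta> u))\<^sup>2)) *
        exp (- (y i)\<^sup>2 / (2 * (LBINT u:{grid n (i - 1)..grid n i}. (sqrt (sq_vol n m N \<theta> u))\<^sup>2)))"
  note cover = UN_bin_indices[OF assms(1-3)]
  have "pseudo_likelihood n y (\<lambda>u. sqrt (sq_vol n m N \<theta> u)) = prod ?g (\<Union>k\<in>{1..N}. bin_indices n m N k)"
    unfolding pseudo_likelihood_def cover ..
  also have "\<dots> = (\<Prod>k=1..N. prod ?g (bin_indices n m N k))"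
    using disjoint_bin_indices[of n m N]
    by (intro prod.UNION_disjoint) (auto simp: disjoint_family_on_def, auto simp: bin_indices_def)
  also have "\<dots> = (\<Prod>k=1..N. \<Prod>i\<in>bin_indices n m N k.
      sqrt (real n / (2 * pi)) * ig_weight (1 / 2) (real n * (y i)\<^sup>2 / 2) (\<theta> k))"
  proof (intro prod.cong refl)
    fix k i assume k: "k \<in> {1..N}" and i: "i \<in> bin_indices n m N k"
    have "i \<in> {1..n}" using k i cover by blast
    then have "(LBINT u:{grid n (i - 1)..grid n i}. (sqrt (sq_vol n m N \<theta> u))\<^sup>2) = \<theta> k / real n"
      using \<open>0 < n\<close> k i pos by (intro integral_sq_vol_cell)
    then show "?g i = sqrt (real n / (2 * pi)) * ig_weight (1 / 2) (real n * (y i)\<^sup>2 / 2) (\<theta> k)"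
      using gaussian_factor_eq[OF \<open>0 < n\<close> pos[OF k], of "y i"] by presburger
  qed
  also have "\<dots> = (\<Prod>k=1..N. sqrt (real n / (2 * pi)) ^ card (bin_indices n m N k) *
      ig_weight (real (card (bin_indices n m N k)) / 2)
        (real n * (\<Sum>i\<in>bin_indices n m N k. (y i)\<^sup>2) / 2) (\<theta> k))"
    using pos
    by (intro prod.cong refl)
       (simp add: prod.distrib prod_ig_weight sum_distrib_left sum_divide_distrib)
  finally show ?thesis .
qed

section \<open>Product measures and independent coordinates\<close>

text \<open>Independence of the coordinates expresses the law of the coordinate vector as the product of its
  marginals, and on a product space that vector is the identity map.\<close>

lemma eq_PiM_of_indep_coordinates:
  fixes M :: "('i \<Rightarrow> real) measure"
  assumes "prob_space M" and "I \<noteq> {}"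
    and sets: "sets M = sets (PiM I (\<lambda>_. borel))"
    and indep: "prob_space.indep_vars M (\<lambda>_. borel) (\<lambda>i x. x i) I"
    and marginal: "\<And>i. i \<in> I \<Longrightarrow> distr M borel (\<lambda>x. x i) = D i"
  shows "M = PiM I D"
proof -
  interpret prob_space M by fact
  have rv: "random_variable borel (\<lambda>x. x i)" if "i \<in> I" for i
    using that by (subst measurable_cong_sets[OF sets refl]) simp
  have "M = distr M M (\<lambda>x. x)" by simp
  also have "\<dots> = distr M (PiM I (\<lambda>_. borel)) (\<lambda>x. \<lambda>i\<in>I. x i)"
    by (rule distr_cong) (auto simp: sets sets_eq_imp_space_eq[OF sets] space_PiM PiE_iff extensional_restrict)
  also have "\<dots> = PiM I (\<lambda>i. distr M borel (\<lambda>x. x i))"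
    using indep indep_vars_iff_distr_eq_PiM'[OF \<open>I \<noteq> {}\<close>, of "\<lambda>i x. x i" "\<lambda>_. borel"] rv by simp
  also have "\<dots> = PiM I D"
    using marginal by (intro PiM_cong) auto
  finally show ?thesis .
qed

lemma indep_coordinates_PiM:
  fixes D :: "'i \<Rightarrow> real measure"
  assumes D: "\<And>i. prob_space (D i)" "\<And>i. sets (D i) = sets borel"
    and "I \<noteq> {}"
  shows "prob_space.indep_vars (PiM I D) (\<lambda>_. borel) (\<lambda>i x. x i) I"
    and "i \<in> I \<Longrightarrow> distr (PiM I D) borel (\<lambda>x. x i) = D i"
proof -
  interpret P: prob_space "PiM I D" by (rule prob_space_PiM) (rule D)
  have sets: "sets (PiM I D) = sets (PiM I (\<lambda>_. borel))"
    by (intro sets_PiM_cong) (auto simp: D)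
  have marginal: "distr (PiM I D) borel (\<lambda>x. x i) = D i" if "i \<in> I" for i
    using distr_PiM_component[of I D i] D that by (simp cong: distr_cong)
  have rv: "P.random_variable borel (\<lambda>x. x i)" if "i \<in> I" for i
    using that by (subst measurable_cong_sets[OF sets refl]) simp
  have "distr (PiM I D) (PiM I (\<lambda>_. borel)) (\<lambda>x. \<lambda>i\<in>I. x i) = distr (PiM I D) (PiM I D) (\<lambda>x. x)"
    by (rule distr_cong) (auto simp: sets space_PiM PiE_iff extensional_restrict)
  also have "\<dots> = PiM I (\<lambda>i. distr (PiM I D) borel (\<lambda>x. x i))"
    using marginal by (auto simp: intro!: PiM_cong)
  finally show "P.indep_vars (\<lambda>_. borel) (\<lambda>i x. x i) I"
    using P.indep_vars_iff_distr_eq_PiM'[OF \<open>I \<noteq> {}\<close>, of "\<lambda>i x. x i" "\<lambda>_. borel"] rv by simp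
  show "i \<in> I \<Longrightarrow> distr (PiM I D) borel (\<lambda>x. x i) = D i" by (rule marginal)
qed

section \<open>The posterior\<close>

text \<open>The whole posterior at once.  The closed form of the likelihood is available almost surely under
  the prior, because inverse gamma variables are positive; it is a product of functions of single
  coordinates, so each coordinate is updated separately by conjugacy.\<close>

theorem posterior_eq_PiM_inv_gamma:
  assumes "0 < m" "0 < N" "m * N \<le> n" "0 < \<alpha>" "0 < \<beta>"
  shows "posterior n m N y (PiM {1..N} (\<lambda>_. inv_gamma \<alpha> \<beta>)) =
    PiM {1..N} (\<lambda>k. inv_gamma (\<alpha> + real (card (bin_indices n m N k)) / 2)
      (\<beta> + real n * (\<Sum>i\<in>bin_indices n m N k. (y i)\<^sup>2) / 2))"
proof -
  have "0 < n" using assms by (metis mult_pos_pos less_le_trans)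
  let ?prior = "PiM {1..N} (\<lambda>_. inv_gamma \<alpha> \<beta>)"
  define c p q where "c k = sqrt (real n / (2 * pi)) ^ card (bin_indices n m N k)"
    and "p k = real (card (bin_indices n m N k)) / 2"
    and "q k = real n * (\<Sum>i\<in>bin_indices n m N k. (y i)\<^sup>2) / 2" for k
  have c: "0 < c k" and p: "0 \<le> p k" and q: "0 \<le> q k" for k
    using \<open>0 < n\<close> by (auto simp: c_def p_def q_def sum_nonneg)
  note conj = inv_gamma_conjugacy[OF assms(4,5) p q c]
  have prob: "prob_space (inv_gamma \<alpha> \<beta>)"
    using assms by (intro prob_space_inv_gamma)
  have "AE \<theta> in ?prior. \<forall>k\<in>{1..N}. 0 < \<theta> k"
    using prob AE_inv_gamma_pos by (intro eventually_ball_finite ballI AE_PiM_component) auto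
  then have "AE \<theta> in ?prior. pseudo_likelihood n y (\<lambda>u. sqrt (sq_vol n m N \<theta> u))
      = (\<Prod>k\<in>{1..N}. c k * ig_weight (p k) (q k) (\<theta> k))"
    unfolding c_def p_def q_def
    by eventually_elim (rule pseudo_likelihood_factorization[OF assms(1-3)], blast)
  then have "posterior n m N y ?prior
      = normalized_density ?prior (\<lambda>\<theta>. \<Prod>k\<in>{1..N}. c k * ig_weight (p k) (q k) (\<theta> k))"
    unfolding posterior_def by (rule normalized_density_cong_AE)
  also have "\<dots> = PiM {1..N} (\<lambda>k. normalized_density (inv_gamma \<alpha> \<beta>) (\<lambda>x. c k * ig_weight (p k) (q k) x))"
    using prob conj(1,2)
    by (intro normalized_density_PiM) (auto intro: prob_space_imp_sigma_finite simp: less_imp_le[OF c])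
  also have "\<dots> = PiM {1..N} (\<lambda>k. inv_gamma (\<alpha> + p k) (\<beta> + q k))"
    by (simp only: conj(3))
  finally show ?thesis by (simp add: p_def q_def)
qed

theorem lemma1:
  fixes m n N r :: nat and \<alpha> \<beta> :: real
    and X :: "real \<Rightarrow> 'w \<Rightarrow> real" and \<omega> :: 'w
    and prior :: "(nat \<Rightarrow> real) measure"
  defines "Y \<equiv> increment n (\<lambda>t. X t \<omega>)"
  defines "post \<equiv> posterior n m N Y prior"
  assumes "0 < m" and "m < n"
    and "n = m * N + r" and "r < m" and "N = n div m"
    and "0 < \<alpha>" and "0 < \<beta>"
    and "prob_space prior"
    and "sets prior = sets (Pi\<^sub>M {1..N} (\<lambda>_. borel))"
    and "prob_space.indep_vars prior (\<lambda>_. borel) (\<lambda>k \<theta>. \<theta> k) {1..N}"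
    and "\<And>k. k \<in> {1..N} \<Longrightarrow> distr prior borel (\<lambda>\<theta>. \<theta> k) = inv_gamma \<alpha> \<beta>"
  shows "prob_space post
    \<and> prob_space.indep_vars post (\<lambda>_. borel) (\<lambda>k \<theta>. \<theta> k) {1..N}
    \<and> (\<forall>k\<in>{1..N - 1}. distr post borel (\<lambda>\<theta>. \<theta> k) =
         inv_gamma (\<alpha> + real m / 2)
           (\<beta> + real n * (\<Sum>i=(k - 1) * m + 1..k * m. (Y i)\<^sup>2) / 2))
    \<and> distr post borel (\<lambda>\<theta>. \<theta> N) =
         inv_gamma (\<alpha> + real (m + r) / 2)
           (\<beta> + real n * (\<Sum>i=(N - 1) * m + 1..n. (Y i)\<^sup>2) / 2)"
proof -
  have "0 < N"
    using \<open>0 < m\<close> \<open>m < n\<close> \<open>N = n div m\<close> by (simp add: div_greater_zero_iff)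
  then have ne: "{1..N} \<noteq> {}" by simp
  have prior: "prior = PiM {1..N} (\<lambda>_. inv_gamma \<alpha> \<beta>)"
    using eq_PiM_of_indep_coordinates[OF assms(10) ne assms(11,12), of "\<lambda>_. inv_gamma \<alpha> \<beta>"] assms(13)
    by blast
  define D where "D k = inv_gamma (\<alpha> + real (card (bin_indices n m N k)) / 2)
      (\<beta> + real n * (\<Sum>i\<in>bin_indices n m N k. (Y i)\<^sup>2) / 2)" for k
  have post: "post = PiM {1..N} D"
    using posterior_eq_PiM_inv_gamma[of m N n \<alpha> \<beta> Y] assms(3,5,8,9) \<open>0 < N\<close>
    by (simp add: post_def prior D_def[abs_def])
  have D: "prob_space (D k)" "sets (D k) = sets borel" for k
    using \<open>0 < \<alpha>\<close> \<open>0 < \<beta>\<close>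
    by (auto simp: D_def intro!: prob_space_inv_gamma add_pos_nonneg mult_nonneg_nonneg sum_nonneg)
  have inner: "D k = inv_gamma (\<alpha> + real m / 2)
      (\<beta> + real n * (\<Sum>i=(k - 1) * m + 1..k * m. (Y i)\<^sup>2) / 2)" if "k \<in> {1..N - 1}" for k
  proof -
    have "bin_indices n m N k = {(k - 1) * m + 1..k * m}"
      using that by (auto simp: bin_indices_def)
    moreover have "card {(k - 1) * m + 1..k * m} = m"
      using that by (cases k) auto
    ultimately show ?thesis by (simp add: D_def)
  qed
  have last: "D N = inv_gamma (\<alpha> + real (m + r) / 2)
      (\<beta> + real n * (\<Sum>i=(N - 1) * m + 1..n. (Y i)\<^sup>2) / 2)"
  proof -
    have "bin_indices n m N N = {(N - 1) * m + 1..n}"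
      by (simp add: bin_indices_def)
    moreover have "card {(N - 1) * m + 1..n} = m + r"
      using \<open>0 < N\<close> assms(5) by (cases N) (auto simp: algebra_simps)
    ultimately show ?thesis by (simp add: D_def)
  qed
  have "prob_space post"
    unfolding post by (rule prob_space_PiM) (rule D)
  moreover have "prob_space.indep_vars post (\<lambda>_. borel) (\<lambda>k \<theta>. \<theta> k) {1..N}"
    unfolding post by (rule indep_coordinates_PiM(1)[OF D ne])
  moreover have "distr post borel (\<lambda>\<theta>. \<theta> k) = D k" if "k \<in> {1..N}" for k
    unfolding post using that by (rule indep_coordinates_PiM(2)[OF D ne])
  ultimately show ?thesis
    using inner last \<open>0 < N\<close> by auto
qed

end
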